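(* Let $(X,d,\preccurlyeq)$ be a sequentially increasingly right $K$-complete preordered quasi-metric space. Suppose that for every sequence $(x_n)_{n\in\mathbb{N}}$ in $X$ and every $x\in X$: if $x_n\preccurlyeq x_{n+1}$ for all $n\in\mathbb{N}$ and $x_n\xrightarrow{d}x$, then $x_n\preccurlyeq x$ for all $n\in\mathbb{N}$. Let $\varphi:X\to\mathbb{R}\cup\{\infty\}$ be a proper, bounded below and increasingly lsc function, and for $x\in X$ put $S(x)=\{y\in X: x\preccurlyeq y \text{ and } \varphi(y)+d(y,x)\le\varphi(x)\}$. 1. If the mapping $T:X\to X$ satisfies $$x\preccurlyeq Tx\quad\text{and}\quad d(Tx,x)+\varphi(Tx)\le\varphi(x)$$ for all $x\in\operatorname{dom}\varphi$, then there exists $z\in\operatorname{dom}\varphi$ such that $\varphi(Tz)=\varphi(z)$ and $Tz\in\overline{\{z\}}$. 2. If $T:X\rightrightarrows X$ is a set-valued mapping such that $S(x)\cap Tx\neq\emptyset$ for every $x\in\operatorname{dom}\varphi$, then there exists $z\in\operatorname{dom}\varphi$ such that $\varphi(z)\in\varphi(Tz)$ and $Tz\cap\overline{\{z\}}\ne\emptyset$.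
   Context: A quasi-metric on a set $X$ is a map $d:X\times X\to[0,\infty)$ with $d(x,x)=0$, $d(x,z)\le d(x,y)+d(y,z)$, and $d(x,y)=d(y,x)=0\Rightarrow x=y$ (symmetry is not required). The topology $\tau_d$ is generated by the balls $B_d(x,r)=\{y: d(x,y)<r\}$; all topological notions refer to $\tau_d$. Thus $x_n\xrightarrow{d}x$ means $d(x,x_n)\to0$, and $\overline{A}$ is the $\tau_d$-closure (so $y\in\overline{\{x\}}$ iff $d(y,x)=0$). A preordered quasi-metric space $(X,d,\preccurlyeq)$ is a quasi-metric space with a reflexive and transitive relation $\preccurlyeq$. A sequence is increasing if $x_n\preccurlyeq x_{n+1}$ for all $n$. A sequence is right $K$-Cauchy if for every $\varepsilon>0$ there is $n_\varepsilon$ such that $d(x_m,x_n)<\varepsilon$ whenever $n_\varepsilon\le n<m$. The space is sequentially increasingly right $K$-complete if every increasing right $K$-Cauchy sequence is convergent (with respect to $\tau_d$). For $\varphi:X\to\mathbb{R}\cup\{\infty\}$, $\operatorname{dom}\varphi=\{x:\varphi(x)<\infty\}$; $\varphi$ is proper if $\operatorname{dom}\varphi\ne\emptyset$; $\varphi$ is increasingly lsc if $\varphi(x)\le\liminf_n\varphi(x_n)$ for every increasing sequence $(x_n)$ with $x_n\xrightarrow{d}x$. A set-valued mapping $T:X\rightrightarrows X$ assigns to each $x\in X$ a subset $Tx\subseteq X$, and $\varphi(A)=\{\varphi(a):a\in A\}$. *)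

theory Defs
  imports "HOL-Analysis.Analysis"
begin

locale quasi_metric_space =
  fixes X :: "'a set" and d :: "'a \<Rightarrow> 'a \<Rightarrow> real"
  assumes nonneg: "\<lbrakk>x \<in> X; y \<in> X\<rbrakk> \<Longrightarrow> 0 \<le> d x y"
    and refl_zero: "x \<in> X \<Longrightarrow> d x x = 0"
    and triangle: "\<lbrakk>x \<in> X; y \<in> X; z \<in> X\<rbrakk> \<Longrightarrow> d x z \<le> d x y + d y z"
    and separation: "\<lbrakk>x \<in> X; y \<in> X; d x y = 0; d y x = 0\<rbrakk> \<Longrightarrow> x = y"

locale preordered_quasi_metric_space = quasi_metric_space X d
  for X :: "'a set" and d :: "'a \<Rightarrow> 'a \<Rightarrow> real" +
  fixes le :: "'a \<Rightarrow> 'a \<Rightarrow> bool"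
  assumes reflp_on_le: "reflp_on X le"
    and transp_on_le: "transp_on X le"

definition qball :: "'a set \<Rightarrow> ('a \<Rightarrow> 'a \<Rightarrow> real) \<Rightarrow> 'a \<Rightarrow> real \<Rightarrow> 'a set" where
  "qball X d x r = {y \<in> X. d x y < r}"

definition qtopology :: "'a set \<Rightarrow> ('a \<Rightarrow> 'a \<Rightarrow> real) \<Rightarrow> 'a topology" where
  "qtopology X d = topology_generated_by {qball X d x r | x r. x \<in> X \<and> 0 < r}"

definition increasing_seq :: "('a \<Rightarrow> 'a \<Rightarrow> bool) \<Rightarrow> (nat \<Rightarrow> 'a) \<Rightarrow> bool" where
  "increasing_seq le xs \<longleftrightarrow> (\<forall>n. le (xs n) (xs (Suc n)))"

text \<open>The later index comes first in the distance; for a left K-Cauchy sequence it would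
  come second.\<close>

definition right_K_Cauchy :: "('a \<Rightarrow> 'a \<Rightarrow> real) \<Rightarrow> (nat \<Rightarrow> 'a) \<Rightarrow> bool" where
  "right_K_Cauchy d xs \<longleftrightarrow>
     (\<forall>\<epsilon>>0. \<exists>N. \<forall>n m. N \<le> n \<and> n < m \<longrightarrow> d (xs m) (xs n) < \<epsilon>)"

definition seq_incr_right_K_complete ::
    "'a set \<Rightarrow> ('a \<Rightarrow> 'a \<Rightarrow> real) \<Rightarrow> ('a \<Rightarrow> 'a \<Rightarrow> bool) \<Rightarrow> bool" where
  "seq_incr_right_K_complete X d le \<longleftrightarrow>
     (\<forall>xs. range xs \<subseteq> X \<and> increasing_seq le xs \<and> right_K_Cauchy d xs \<longrightarrow>
        (\<exists>x\<in>X. limitin (qtopology X d) xs x sequentially))"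

text \<open>Functions to \<open>\<real> \<union> {\<infinity>}\<close> are \<open>ereal\<close>-valued; that they avoid \<open>-\<infinity>\<close> on \<open>X\<close> is
  assumed separately.\<close>

definition edom :: "'a set \<Rightarrow> ('a \<Rightarrow> ereal) \<Rightarrow> 'a set" where
  "edom X \<phi> = {x \<in> X. \<phi> x < \<infinity>}"

definition proper_on :: "'a set \<Rightarrow> ('a \<Rightarrow> ereal) \<Rightarrow> bool" where
  "proper_on X \<phi> \<longleftrightarrow> edom X \<phi> \<noteq> {}"

definition bounded_below_on :: "'a set \<Rightarrow> ('a \<Rightarrow> ereal) \<Rightarrow> bool" where
  "bounded_below_on X \<phi> \<longleftrightarrow> (\<exists>c::real. \<forall>x\<in>X. ereal c \<le> \<phi> x)"

definition increasingly_lsc ::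
    "'a set \<Rightarrow> ('a \<Rightarrow> 'a \<Rightarrow> real) \<Rightarrow> ('a \<Rightarrow> 'a \<Rightarrow> bool) \<Rightarrow> ('a \<Rightarrow> ereal) \<Rightarrow> bool" where
  "increasingly_lsc X d le \<phi> \<longleftrightarrow>
     (\<forall>xs. \<forall>x\<in>X. range xs \<subseteq> X \<and> increasing_seq le xs \<and>
        limitin (qtopology X d) xs x sequentially \<longrightarrow> \<phi> x \<le> liminf (\<lambda>n. \<phi> (xs n)))"

definition S_set ::
    "'a set \<Rightarrow> ('a \<Rightarrow> 'a \<Rightarrow> real) \<Rightarrow> ('a \<Rightarrow> 'a \<Rightarrow> bool) \<Rightarrow> ('a \<Rightarrow> ereal) \<Rightarrow> 'a \<Rightarrow> 'a set" where
  "S_set X d le \<phi> x = {y \<in> X. le x y \<and> \<phi> y + ereal (d y x) \<le> \<phi> x}"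

context quasi_metric_space
begin

lemma topspace_qtopology: "topspace (qtopology X d) = X"
proof -
  have "\<Union>{qball X d x r | x r. x \<in> X \<and> 0 < r} = X"
  proof
    show "\<Union>{qball X d x r | x r. x \<in> X \<and> 0 < r} \<subseteq> X"
      by (auto simp: qball_def)
    show "X \<subseteq> \<Union>{qball X d x r | x r. x \<in> X \<and> 0 < r}"
    proof
      fix x assume x: "x \<in> X"
      then have "x \<in> qball X d x 1" by (simp add: qball_def refl_zero)
      moreover have "(0::real) < 1" by simp
      ultimately show "x \<in> \<Union>{qball X d x r | x r. x \<in> X \<and> 0 < r}" using x by blast
    qed
  qed
  then show ?thesis
    unfolding qtopology_def topology_generated_by_topspace .
qed

lemma openin_qball: "x \<in> X \<Longrightarrow> 0 < r \<Longrightarrow> openin (qtopology X d) (qball X d x r)"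
  unfolding qtopology_def by (rule topology_generated_by_Basis) blast

lemma openin_qtopology_iff:
  "openin (qtopology X d) U \<longleftrightarrow> U \<subseteq> X \<and> (\<forall>x\<in>U. \<exists>r>0. qball X d x r \<subseteq> U)"
proof
  assume U: "openin (qtopology X d) U"
  have UX: "U \<subseteq> X" using openin_subset[OF U] topspace_qtopology by simp
  have "generate_topology_on {qball X d x r | x r. x \<in> X \<and> 0 < r} U"
    using U by (simp add: qtopology_def openin_topology_generated_by_iff)
  then have "\<forall>x\<in>U. \<exists>r>0. qball X d x r \<subseteq> U"
  proof induction
    case Empty
    then show ?case by simp
  next
    case (Int a b)
    show ?case
    proof
      fix x assume "x \<in> a \<inter> b"
      then obtain r s where rs: "r > 0" "qball X d x r \<subseteq> a" "s > 0" "qball X d x s \<subseteq> b"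
        using Int.IH by blast
      have "qball X d x (min r s) \<subseteq> a \<inter> b"
        using rs by (auto simp: qball_def)
      then show "\<exists>r>0. qball X d x r \<subseteq> a \<inter> b" using rs by (meson min_less_iff_conj)
    qed
  next
    case (UN K)
    then show ?case by (meson Union_iff Union_upper subset_trans)
  next
    case (Basis s)
    then obtain a r where s: "s = qball X d a r" "a \<in> X" by blast
    show ?case
    proof
      fix y assume "y \<in> s"
      then have y: "y \<in> X" "d a y < r" using s by (auto simp: qball_def)
      have "qball X d y (r - d a y) \<subseteq> s"
      proof
        fix w assume "w \<in> qball X d y (r - d a y)"
        then have w: "w \<in> X" "d y w < r - d a y" by (auto simp: qball_def)
        then show "w \<in> s" using triangle[OF s(2) y(1) w(1)] s by (simp add: qball_def)
      qed
      then show "\<exists>r>0. qball X d y r \<subseteq> s" using y by (intro exI[of _ "r - d a y"]) auto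
    qed
  qed
  then show "U \<subseteq> X \<and> (\<forall>x\<in>U. \<exists>r>0. qball X d x r \<subseteq> U)" using UX by blast
next
  assume R: "U \<subseteq> X \<and> (\<forall>x\<in>U. \<exists>r>0. qball X d x r \<subseteq> U)"
  show "openin (qtopology X d) U"
  proof (subst openin_subopen, intro ballI)
    fix x assume x: "x \<in> U"
    then obtain r where r: "r > 0" "qball X d x r \<subseteq> U" using R by blast
    have "x \<in> X" using x R by blast
    then have "openin (qtopology X d) (qball X d x r)" "x \<in> qball X d x r"
      using r refl_zero by (auto simp: openin_qball) (simp add: qball_def)
    then show "\<exists>T. openin (qtopology X d) T \<and> x \<in> T \<and> T \<subseteq> U" using r by blast
  qed
qed

lemma limitin_qtopology_iff:
  assumes "range xs \<subseteq> X"
  shows "limitin (qtopology X d) xs x sequentially \<longleftrightarrow> x \<in> X \<and> (\<lambda>n. d x (xs n)) \<longlonglongrightarrow> 0"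
proof
  assume L: "limitin (qtopology X d) xs x sequentially"
  then have x: "x \<in> X" using limitin_topspace[OF L] by (simp only: topspace_qtopology)
  have "\<forall>\<^sub>F n in sequentially. dist (d x (xs n)) 0 < r" if "r > 0" for r
  proof -
    have "x \<in> qball X d x r" using x that by (simp add: qball_def refl_zero)
    then have "\<forall>\<^sub>F n in sequentially. xs n \<in> qball X d x r"
      using L openin_qball[OF x that] by (simp add: limitin_def)
    then show ?thesis
    proof eventually_elim
      case (elim n)
      then have "xs n \<in> X" "d x (xs n) < r" by (auto simp: qball_def)
      then show ?case using nonneg[OF x, of "xs n"] by (simp add: dist_real_def)
    qed
  qed
  then show "x \<in> X \<and> (\<lambda>n. d x (xs n)) \<longlonglongrightarrow> 0" using x by (simp add: tendsto_iff)
next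
  assume R: "x \<in> X \<and> (\<lambda>n. d x (xs n)) \<longlonglongrightarrow> 0"
  have "\<forall>\<^sub>F n in sequentially. xs n \<in> U" if U: "openin (qtopology X d) U" "x \<in> U" for U
  proof -
    have "\<exists>r>0. qball X d x r \<subseteq> U"
      using iffD1[OF openin_qtopology_iff U(1)] U(2) by (elim conjE) (rule bspec)
    then obtain r where r: "r > 0" "qball X d x r \<subseteq> U" by (elim exE conjE)
    have "\<forall>\<^sub>F n in sequentially. d x (xs n) < r"
      by (rule order_tendstoD(2)[OF conjunct2[OF R] r(1)])
    then show ?thesis
    proof eventually_elim
      case (elim n)
      have "xs n \<in> X" using assms by blast
      with elim have "xs n \<in> qball X d x r" by (simp add: qball_def)
      then show ?case using r(2) by blast
    qed
  qed
  then show "limitin (qtopology X d) xs x sequentially"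
    using R by (simp add: limitin_def topspace_qtopology)
qed

lemma in_closure_of_singleton_iff:
  assumes "x \<in> X"
  shows "y \<in> qtopology X d closure_of {x} \<longleftrightarrow> y \<in> X \<and> d y x = 0"
proof
  assume C: "y \<in> qtopology X d closure_of {x}"
  then have y: "y \<in> X" by (simp add: in_closure_of topspace_qtopology)
  have "d y x < r" if "r > 0" for r
  proof -
    have "y \<in> qball X d y r" using y that by (simp add: qball_def refl_zero)
    then have "x \<in> qball X d y r"
      using C openin_qball[OF y that] by (auto simp: in_closure_of)
    then show ?thesis by (simp add: qball_def)
  qed
  from this[of "d y x"] show "y \<in> X \<and> d y x = 0"
    using y nonneg[OF y assms] by linarith
next
  assume R: "y \<in> X \<and> d y x = 0"
  have "x \<in> U" if "openin (qtopology X d) U" "y \<in> U" for U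
  proof -
    have "\<exists>r>0. qball X d y r \<subseteq> U"
      using iffD1[OF openin_qtopology_iff that(1)] that(2) by (elim conjE) (rule bspec)
    then obtain r where r: "r > 0" "qball X d y r \<subseteq> U" by (elim exE conjE)
    have "x \<in> qball X d y r" using R assms r(1) by (simp add: qball_def)
    then show ?thesis using r(2) by (rule subsetD[rotated])
  qed
  then show "y \<in> qtopology X d closure_of {x}"
    using R by (auto simp: in_closure_of topspace_qtopology)
qed

end

end

theory Submission
  imports Defs
begin

text \<open>The sets \<open>S x\<close> decrease along chains \<open>x' \<in> S x\<close>. Choosing \<open>x (n+1) \<in> S (x n)\<close> so
  that \<open>\<phi> (x (n+1))\<close> is almost the infimum of \<open>\<phi>\<close> over \<open>S (x n)\<close> gives an increasing sequence with
  \<open>d (x m) (x n) \<le> \<phi> (x n) - \<phi> (x m)\<close> for \<open>n \<le> m\<close>, which is therefore right K-Cauchy. Its limit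
  \<open>z\<close> lies in every \<open>S (x n)\<close>, so each \<open>y \<in> S z\<close> has \<open>\<phi> y \<ge> lim \<phi> (x n) \<ge> \<phi> z\<close>; the
  definition of \<open>S z\<close> then forces \<open>\<phi> y = \<phi> z\<close> and \<open>d y z = 0\<close>. Any point of \<open>S z\<close> supplied by
  \<open>T\<close> proves the theorem.\<close>

context preordered_quasi_metric_space
begin

lemma S_set_refl: "x \<in> X \<Longrightarrow> x \<in> S_set X d le \<phi> x"
  using reflp_on_le by (simp add: S_set_def refl_zero reflp_on_def)

text \<open>The two inequalities defining membership add up, and the triangle inequality through
  \<open>y\<close> bounds \<open>d w x\<close> by the two distances.\<close>

lemma S_set_trans:
  assumes "x \<in> X" "y \<in> S_set X d le \<phi> x" "w \<in> S_set X d le \<phi> y"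
  shows "w \<in> S_set X d le \<phi> x"
proof -
  have X: "y \<in> X" "w \<in> X" and le: "le x y" "le y w"
    and yx: "\<phi> y + ereal (d y x) \<le> \<phi> x" and wy: "\<phi> w + ereal (d w y) \<le> \<phi> y"
    using assms by (auto simp: S_set_def)
  have "\<phi> w + ereal (d w x) \<le> \<phi> w + ereal (d w y + d y x)"
    using triangle[OF X(2,1) assms(1)] by (intro add_left_mono) simp
  also have "\<dots> = (\<phi> w + ereal (d w y)) + ereal (d y x)"
    by (simp add: add.assoc)
  also have "\<dots> \<le> \<phi> x"
    using add_right_mono[OF wy] yx order_trans by blast
  finally show ?thesis
    using X le transp_on_le assms(1) unfolding S_set_def transp_on_def by blast
qed

text \<open>Moving inside the sets \<open>S x\<close> never leaves the domain, so values of \<phi>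
  along a chain can be handled as reals.\<close>

lemma S_set_subset_edom:
  assumes "x \<in> edom X \<phi>"
  shows "S_set X d le \<phi> x \<subseteq> edom X \<phi>"
proof
  fix y assume "y \<in> S_set X d le \<phi> x"
  then have "y \<in> X" "\<phi> y + ereal (d y x) < \<infinity>"
    using assms by (auto simp: S_set_def edom_def)
  then show "y \<in> edom X \<phi>" by (cases "\<phi> y") (auto simp: edom_def)
qed

text \<open>The infimum is taken over reals: \<open>S x\<close> contains \<open>x\<close>, and
  \<open>c\<close> bounds \<open>f\<close> from below on it. The slack \<epsilon> makes up for an
  infimum that may not be attained.\<close>

lemma ex_almost_minimal_in_S_set:
  fixes f :: "'a \<Rightarrow> real"
  assumes x: "x \<in> edom X \<phi>" and "\<epsilon> > 0"
    and f: "\<And>y. y \<in> edom X \<phi> \<Longrightarrow> \<phi> y = ereal (f y)"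
    and c: "\<And>y. y \<in> edom X \<phi> \<Longrightarrow> c \<le> f y"
  shows "\<exists>y \<in> S_set X d le \<phi> x. \<forall>w \<in> S_set X d le \<phi> x. f y \<le> f w + \<epsilon>"
proof -
  let ?A = "f ` S_set X d le \<phi> x"
  have ne: "?A \<noteq> {}" using S_set_refl x by (auto simp: edom_def)
  have bdd: "bdd_below ?A"
    using S_set_subset_edom[OF x] c by (intro bdd_belowI[of _ c]) auto
  obtain y where y: "y \<in> S_set X d le \<phi> x" "f y < Inf ?A + \<epsilon>"
    using cInf_lessD[OF ne, of "Inf ?A + \<epsilon>"] \<open>\<epsilon> > 0\<close> by auto
  have "f y \<le> f w + \<epsilon>" if "w \<in> S_set X d le \<phi> x" for w
    using cInf_lower[OF imageI[OF that] bdd] y(2) by linarith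
  with y(1) show ?thesis by blast
qed

text \<open>An Ekeland-type principle that does not mention \<open>T\<close>: one such point
  \<open>z\<close> serves both parts of the theorem.\<close>

proposition ex_minimal_S_set:
  assumes complete: "seq_incr_right_K_complete X d le"
    and upper: "\<And>xs x. \<lbrakk>range xs \<subseteq> X; x \<in> X; \<And>n. le (xs n) (xs (Suc n));
           limitin (qtopology X d) xs x sequentially\<rbrakk> \<Longrightarrow> \<forall>n. le (xs n) x"
    and proper: "proper_on X \<phi>"
    and bdd: "bounded_below_on X \<phi>"
    and lsc: "increasingly_lsc X d le \<phi>"
  shows "\<exists>z \<in> edom X \<phi>. \<forall>y \<in> S_set X d le \<phi> z. \<phi> y = \<phi> z \<and> d y z = 0"
proof -
  let ?S = "S_set X d le \<phi>"
  obtain c where c: "\<And>x. x \<in> X \<Longrightarrow> ereal c \<le> \<phi> x"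
    using bdd by (auto simp: bounded_below_on_def)
  obtain x0 where x0: "x0 \<in> edom X \<phi>" using proper by (auto simp: proper_on_def)
  \<comment> \<open>A real version of \<phi>, so that differences make sense. It agrees with \<phi>
    on the domain, where the lower bound rules out the value minus infinity.\<close>
  define f where "f x = real_of_ereal (\<phi> x)" for x
  have f: "\<phi> x = ereal (f x)" if "x \<in> edom X \<phi>" for x
    using that c[of x] by (cases "\<phi> x") (auto simp: edom_def f_def)
  have cf: "c \<le> f x" if "x \<in> edom X \<phi>" for x
    using c[of x] f[OF that] that by (auto simp: edom_def)
  have S_dist: "d y x \<le> f x - f y" if "x \<in> edom X \<phi>" "y \<in> ?S x" for x y
  proof -
    have "y \<in> edom X \<phi>" using S_set_subset_edom that by blast
    then show ?thesis using that f by (auto simp: S_set_def)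
  qed
  \<comment> \<open>The tolerance at stage \<open>n\<close> is 1/(n+1), which is positive and tends
    to 0.\<close>
  have "\<exists>xs. \<forall>n. xs n \<in> edom X \<phi> \<and> (xs (Suc n) \<in> ?S (xs n) \<and>
          (\<forall>w \<in> ?S (xs n). f (xs (Suc n)) \<le> f w + inverse (real (Suc n))))"
  proof (rule dependent_nat_choice)
    show "\<exists>x. x \<in> edom X \<phi>" using x0 by blast
  next
    fix x n assume x: "x \<in> edom X \<phi>"
    show "\<exists>y. y \<in> edom X \<phi> \<and> (y \<in> ?S x \<and> (\<forall>w \<in> ?S x. f y \<le> f w + inverse (real (Suc n))))"
      using ex_almost_minimal_in_S_set[OF x _ f cf, of "inverse (real (Suc n))"]
        S_set_subset_edom[OF x] by auto
  qed
  then obtain xs where xs: "\<And>n. xs n \<in> edom X \<phi>" and step: "\<And>n. xs (Suc n) \<in> ?S (xs n)"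
    and near: "\<And>n w. w \<in> ?S (xs n) \<Longrightarrow> f (xs (Suc n)) \<le> f w + inverse (real (Suc n))"
    by blast
  have xsX: "xs n \<in> X" for n using xs[of n] by (simp add: edom_def)
  then have ran: "range xs \<subseteq> X" by blast
  have inc: "le (xs n) (xs (Suc n))" for n using step[of n] by (simp add: S_set_def)
  have chain: "xs m \<in> ?S (xs n)" if "n \<le> m" for n m
    using that
  proof (induction m rule: dec_induct)
    case base
    show ?case by (rule S_set_refl[OF xsX])
  next
    case (step m)
    then show ?case using S_set_trans[OF xsX] \<open>\<And>n. xs (Suc n) \<in> ?S (xs n)\<close> by blast
  qed
  have dist: "d (xs m) (xs n) \<le> f (xs n) - f (xs m)" if "n \<le> m" for n m
    by (rule S_dist[OF xs chain[OF that]])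
  have anti: "decseq (\<lambda>n. f (xs n))"
    unfolding decseq_def using dist nonneg[OF xsX xsX] by (smt (verit))
  obtain L where L: "(\<lambda>n. f (xs n)) \<longlonglongrightarrow> L" and Lle: "\<And>n. L \<le> f (xs n)"
    using decseq_convergent[OF anti, of c] cf[OF xs] by blast
  have "right_K_Cauchy d xs"
    unfolding right_K_Cauchy_def
  proof (intro allI impI)
    fix \<epsilon> :: real assume "\<epsilon> > 0"
    then obtain N where N: "f (xs N) < L + \<epsilon>"
      using order_tendstoD(2)[OF L, of "L + \<epsilon>"] by (auto simp: eventually_sequentially)
    \<comment> \<open>The distance is at most \<open>f (xs n) - f (xs m)\<close>, hence at most
      \<open>f (xs N) - L\<close>.\<close>
    have "d (xs m) (xs n) < \<epsilon>" if "N \<le> n" "n < m" for n m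
      using dist[of n m] that Lle[of m] decseqD[OF anti that(1)] N by linarith
    then show "\<exists>N. \<forall>n m. N \<le> n \<and> n < m \<longrightarrow> d (xs m) (xs n) < \<epsilon>" by blast
  qed
  then obtain z where zX: "z \<in> X" and lim: "limitin (qtopology X d) xs z sequentially"
    using complete ran inc unfolding seq_incr_right_K_complete_def increasing_seq_def by blast
  have dz: "(\<lambda>n. d z (xs n)) \<longlonglongrightarrow> 0" using lim limitin_qtopology_iff[OF ran] by simp
  have "\<phi> z \<le> liminf (\<lambda>n. \<phi> (xs n))"
    using lsc ran inc zX lim unfolding increasingly_lsc_def increasing_seq_def by blast
  also have "\<dots> = ereal L"
    using L by (intro lim_imp_Liminf) (simp_all add: f[OF xs])
  finally have phi_z: "\<phi> z \<le> ereal L" .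
  then have z: "z \<in> edom X \<phi>" using zX by (auto simp: edom_def)
  have fz: "f z \<le> L" using phi_z f[OF z] by simp
  have zS: "z \<in> ?S (xs n)" for n
  proof -
    \<comment> \<open>Going from \<open>z\<close> to \<open>xs n\<close> through a late
      \<open>xs m\<close> uses \<open>d z (xs m)\<close>, exactly the distance that convergence
      sends to 0; letting \<open>m\<close> grow leaves \<open>f (xs n) - L\<close>.\<close>
    have "(\<lambda>m. d z (xs m) + (f (xs n) - f (xs m))) \<longlonglongrightarrow> 0 + (f (xs n) - L)"
      by (intro tendsto_intros dz L)
    moreover have "\<forall>\<^sub>F m in sequentially. d z (xs n) \<le> d z (xs m) + (f (xs n) - f (xs m))"
      using eventually_ge_at_top[of n]
    proof eventually_elim
      case (elim m)
      then show ?case using triangle[OF zX xsX[of m] xsX[of n]] dist[of n m] by linarith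
    qed
    ultimately have "d z (xs n) \<le> f (xs n) - L"
      using tendsto_lowerbound[of _ "0 + (f (xs n) - L)"] by fastforce
    moreover have "le (xs n) z" using upper[OF ran zX inc lim] by blast
    ultimately show ?thesis using fz zX f[OF z] f[OF xs] by (simp add: S_set_def)
  qed
  have "\<phi> y = \<phi> z \<and> d y z = 0" if y: "y \<in> ?S z" for y
  proof -
    have yX: "y \<in> edom X \<phi>" using S_set_subset_edom[OF z] y by blast
    \<comment> \<open>By transitivity through \<open>z\<close>, the point \<open>y\<close> competed
      in the choice of every \<open>xs (Suc n)\<close>.\<close>
    have "f (xs (Suc n)) \<le> f y + inverse (real (Suc n))" for n
      by (rule near[OF S_set_trans[OF xsX zS y]])
    moreover have "(\<lambda>n. f y + inverse (real (Suc n))) \<longlonglongrightarrow> f y + 0"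
      by (intro tendsto_intros LIMSEQ_inverse_real_of_nat)
    ultimately have "L \<le> f y"
      using LIMSEQ_le[OF LIMSEQ_Suc[OF L]] by fastforce
    moreover have "d y z \<le> f z - f y" by (rule S_dist[OF z y])
    moreover have "0 \<le> d y z" using nonneg yX zX by (simp add: edom_def)
    \<comment> \<open>From \<open>f z\<close> \<le> \<open>L\<close> \<le> \<open>f y\<close> and 0
      \<le> \<open>d y z\<close> \<le> \<open>f z - f y\<close>, all these differences
      vanish.\<close>
    ultimately show ?thesis using fz f[OF z] f[OF yX] by simp
  qed
  with z show ?thesis by blast
qed

end

theorem theorem3p7:
  fixes X :: "'a set" and d :: "'a \<Rightarrow> 'a \<Rightarrow> real"
    and le :: "'a \<Rightarrow> 'a \<Rightarrow> bool" and \<phi> :: "'a \<Rightarrow> ereal"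
  assumes "preordered_quasi_metric_space X d le"
    and "seq_incr_right_K_complete X d le"
    and "\<And>xs x. \<lbrakk>range xs \<subseteq> X; x \<in> X; \<And>n. le (xs n) (xs (Suc n));
           limitin (qtopology X d) xs x sequentially\<rbrakk> \<Longrightarrow> \<forall>n. le (xs n) x"
    and "\<phi> \<in> X \<rightarrow> {-\<infinity><..}"
    and "proper_on X \<phi>"
    and "bounded_below_on X \<phi>"
    and "increasingly_lsc X d le \<phi>"
  shows "(\<forall>T :: 'a \<Rightarrow> 'a. T \<in> X \<rightarrow> X \<and>
            (\<forall>x \<in> edom X \<phi>. le x (T x) \<and> ereal (d (T x) x) + \<phi> (T x) \<le> \<phi> x) \<longrightarrow>
            (\<exists>z \<in> edom X \<phi>. \<phi> (T z) = \<phi> z \<and> T z \<in> qtopology X d closure_of {z}))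
       \<and> (\<forall>T :: 'a \<Rightarrow> 'a set. (\<forall>x \<in> X. T x \<subseteq> X) \<and>
            (\<forall>x \<in> edom X \<phi>. S_set X d le \<phi> x \<inter> T x \<noteq> {}) \<longrightarrow>
            (\<exists>z \<in> edom X \<phi>. \<phi> z \<in> \<phi> ` T z \<and> T z \<inter> qtopology X d closure_of {z} \<noteq> {}))"
proof -
  interpret preordered_quasi_metric_space X d le by fact
  obtain z where z: "z \<in> edom X \<phi>"
    and min: "\<And>y. y \<in> S_set X d le \<phi> z \<Longrightarrow> \<phi> y = \<phi> z \<and> d y z = 0"
    using ex_minimal_S_set[OF assms(2,3,5-7)] by blast
  have zX: "z \<in> X" using z by (simp add: edom_def)
  \<comment> \<open>Closure points of a singleton are those with \<open>d y z = 0\<close>, the order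
    of arguments that minimality provides.\<close>
  have cl: "y \<in> qtopology X d closure_of {z}" if "y \<in> S_set X d le \<phi> z" for y
    using in_closure_of_singleton_iff[OF zX] min[OF that] that by (simp add: S_set_def)
  show ?thesis
  proof (intro conjI allI impI)
    fix T :: "'a \<Rightarrow> 'a"
    assume "T \<in> X \<rightarrow> X \<and>
      (\<forall>x \<in> edom X \<phi>. le x (T x) \<and> ereal (d (T x) x) + \<phi> (T x) \<le> \<phi> x)"
    then have "T z \<in> S_set X d le \<phi> z"
      using z zX by (auto simp: S_set_def add.commute)
    then show "\<exists>z \<in> edom X \<phi>. \<phi> (T z) = \<phi> z \<and> T z \<in> qtopology X d closure_of {z}"
      using z min cl by blast
  next
    fix T :: "'a \<Rightarrow> 'a set"
    assume "(\<forall>x \<in> X. T x \<subseteq> X) \<and> (\<forall>x \<in> edom X \<phi>. S_set X d le \<phi> x \<inter> T x \<noteq> {})"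
    then obtain y where y: "y \<in> S_set X d le \<phi> z" "y \<in> T z" using z by blast
    then have "\<phi> z \<in> \<phi> ` T z" using min[OF y(1)] by (metis imageI)
    then show "\<exists>z \<in> edom X \<phi>. \<phi> z \<in> \<phi> ` T z \<and> T z \<inter> qtopology X d closure_of {z} \<noteq> {}"
      using z y cl by blast
  qed
qed

end
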